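(* For every $t\ge 0$, the operator $\mathcal V(t)=Y(t)\otimes Y(t)$ is a Hilbert-Schmidt operator on $H$, i.e. $\mathcal V(t)\in\mathcal H$. Furthermore, $\mathcal V(t)$ is a symmetric and positive definite operator.
   Context: $(\Omega,\mathcal F,\{\mathcal F_t\}_{t\ge0},\mathbb P)$ is a filtered probability space. $H$ is a real separable Hilbert space with inner product $\langle\cdot,\cdot\rangle$ and norm $|\cdot|$; $L(H)$ is the space of bounded linear operators on $H$; $\mathcal H=L_{HS}(H)$ is the Hilbert space of Hilbert-Schmidt operators on $H$. "Positive definite" for a symmetric operator $T$ is used in the sense $\langle Tf,f\rangle\ge0$ for all $f\in H$. For $f,g\in H$ the tensor product is the operator $f\otimes g:=\langle f,\cdot\rangle g$, and $f^{\otimes2}:=f\otimes f$. $\{W(t)\}_{t\ge0}$ is an $H$-valued $\mathcal F_t$-Wiener process with covariance operator $Q_W$ (symmetric, positive definite, trace class). $\mathcal A$ is a densely defined operator on $H$ generating a $C_0$-semigroup $\{\mathcal U(t)\}_{t\ge0}$, $\eta\in L(H)$, $Y_0\in H$. $\{Y(t)\}_{t\ge0}$ is the mild solution of $dY(t)=\mathcal AY(t)\,dt+\eta\,dW(t)$, $Y(0)=Y_0$, i.e. $Y(t)=\mathcal U(t)Y_0+\int_0^t\mathcal U(t-s)\eta\,dW(s)$. The tensor Heston stochastic variance process is $\mathcal V(t):=Y(t)^{\otimes2}$. *)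

theory Defs
  imports "HOL-Probability.Probability"
begin

text \<open>
  A real separable Hilbert space is a type of sort
  \<open>{real_inner, banach, second_countable_topology}\<close>; bounded operators are \<open>'h \<Rightarrow>\<^sub>L 'h\<close>.
  Time is \<open>real\<close>, with all conditions restricted to nonnegative times.
\<close>

subsection \<open>Operators on a Hilbert space\<close>

definition symmetric_op :: "('h::real_inner \<Rightarrow> 'h) \<Rightarrow> bool" where
  "symmetric_op T \<longleftrightarrow> (\<forall>f g. T f \<bullet> g = f \<bullet> T g)"

text \<open>``Positive definite'' is meant in the non-strict sense.\<close>

definition positive_definite_op :: "('h::real_inner \<Rightarrow> 'h) \<Rightarrow> bool" where
  "positive_definite_op T \<longleftrightarrow> (\<forall>f. T f \<bullet> f \<ge> 0)"

definition orthonormal_basis :: "'h::real_inner set \<Rightarrow> bool" where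
  "orthonormal_basis B \<longleftrightarrow>
     pairwise orthogonal B \<and> (\<forall>e\<in>B. norm e = 1) \<and> closure (span B) = UNIV"

definition hilbert_schmidt :: "('h::real_inner \<Rightarrow> 'h) \<Rightarrow> bool" where
  "hilbert_schmidt T \<longleftrightarrow>
     bounded_linear T \<and> (\<exists>B. orthonormal_basis B \<and> (\<lambda>e. (norm (T e))\<^sup>2) summable_on B)"

text \<open>
  The squared Hilbert-Schmidt norm, infinite if the operator is not Hilbert-Schmidt.
  The value does not depend on the chosen basis.
\<close>

definition hs_norm_sq :: "('h::real_inner \<Rightarrow> 'h) \<Rightarrow> ennreal" where
  "hs_norm_sq T = (\<Sum>\<^sub>\<infinity>e\<in>(SOME B. orthonormal_basis B). ennreal ((norm (T e))\<^sup>2))"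

definition op_sqrt :: "('h::real_inner \<Rightarrow>\<^sub>L 'h) \<Rightarrow> ('h \<Rightarrow>\<^sub>L 'h)" where
  "op_sqrt S = (THE R. symmetric_op (blinfun_apply R) \<and> positive_definite_op (blinfun_apply R) \<and>
                       R o\<^sub>L R = S)"

definition op_abs :: "('h::real_inner \<Rightarrow>\<^sub>L 'h) \<Rightarrow> ('h \<Rightarrow>\<^sub>L 'h)" where
  "op_abs T = op_sqrt (Blinfun (adjoint (blinfun_apply T) \<circ> blinfun_apply T))"

definition trace_class :: "('h::real_inner \<Rightarrow>\<^sub>L 'h) \<Rightarrow> bool" where
  "trace_class T \<longleftrightarrow>
     (\<exists>B. orthonormal_basis B \<and> (\<lambda>e. blinfun_apply (op_abs T) e \<bullet> e) summable_on B)"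

definition tensor :: "'h::real_inner \<Rightarrow> 'h \<Rightarrow> ('h \<Rightarrow> 'h)" where
  "tensor f g = (\<lambda>x. (f \<bullet> x) *\<^sub>R g)"


subsection \<open>Semigroups\<close>

definition C0_semigroup :: "(real \<Rightarrow> 'h::real_normed_vector \<Rightarrow>\<^sub>L 'h) \<Rightarrow> bool" where
  "C0_semigroup U \<longleftrightarrow>
     U 0 = id_blinfun \<and>
     (\<forall>s\<ge>0. \<forall>t\<ge>0. U (s + t) = U s o\<^sub>L U t) \<and>
     (\<forall>x. ((\<lambda>t. blinfun_apply (U t) x) \<longlongrightarrow> x) (at_right 0))"

text \<open>
  An unbounded operator is a pair of a domain \<open>D\<close> and a map \<open>A\<close>, whose values outside \<open>D\<close>
  are irrelevant.
\<close>

definition densely_defined_op :: "'h::real_normed_vector set \<Rightarrow> ('h \<Rightarrow> 'h) \<Rightarrow> bool" where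
  "densely_defined_op D A \<longleftrightarrow>
     subspace D \<and> closure D = UNIV \<and>
     (\<forall>x\<in>D. \<forall>y\<in>D. A (x + y) = A x + A y) \<and> (\<forall>c. \<forall>x\<in>D. A (c *\<^sub>R x) = c *\<^sub>R A x)"

definition generates_semigroup ::
  "'h::real_normed_vector set \<Rightarrow> ('h \<Rightarrow> 'h) \<Rightarrow> (real \<Rightarrow> 'h \<Rightarrow>\<^sub>L 'h) \<Rightarrow> bool" where
  "generates_semigroup D A U \<longleftrightarrow>
     D = {x. \<exists>l. ((\<lambda>h. (blinfun_apply (U h) x - x) /\<^sub>R h) \<longlongrightarrow> l) (at_right 0)} \<and>
     (\<forall>x\<in>D. ((\<lambda>h. (blinfun_apply (U h) x - x) /\<^sub>R h) \<longlongrightarrow> A x) (at_right 0))"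


subsection \<open>Wiener processes\<close>

definition filtered_prob_space :: "'a measure \<Rightarrow> (real \<Rightarrow> 'a measure) \<Rightarrow> bool" where
  "filtered_prob_space M F \<longleftrightarrow>
     prob_space M \<and> (\<forall>t\<ge>0. subalgebra M (F t)) \<and>
     (\<forall>s t. 0 \<le> s \<and> s \<le> t \<longrightarrow> sets (F s) \<subseteq> sets (F t))"

text \<open>The law \<open>N(0, v)\<close>; it is the point mass at \<open>0\<close> if \<open>v = 0\<close>.\<close>

definition centered_normal :: "'a measure \<Rightarrow> ('a \<Rightarrow> real) \<Rightarrow> real \<Rightarrow> bool" where
  "centered_normal M X v \<longleftrightarrow>
     X \<in> borel_measurable M \<and>
     (if v = 0 then (AE \<omega> in M. X \<omega> = 0)
      else v > 0 \<and> distributed M lborel X (\<lambda>x. ennreal (normal_density 0 (sqrt v) x)))"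

text \<open>
  An \<open>H\<close>-valued variable is Gaussian if all its one-dimensional projections are. For a symmetric
  \<open>Q\<close> the variances \<open>Q h \<bullet> h\<close> of the projections determine, by polarization, the covariance.
\<close>

definition centered_gaussian ::
  "'a measure \<Rightarrow> ('a \<Rightarrow> 'h::real_inner) \<Rightarrow> ('h \<Rightarrow>\<^sub>L 'h) \<Rightarrow> bool" where
  "centered_gaussian M X Q \<longleftrightarrow>
     X \<in> borel_measurable M \<and>
     (\<forall>h. centered_normal M (\<lambda>\<omega>. X \<omega> \<bullet> h) (blinfun_apply Q h \<bullet> h))"

definition wiener_process ::
  "'a measure \<Rightarrow> (real \<Rightarrow> 'a measure) \<Rightarrow> ('h::real_inner \<Rightarrow>\<^sub>L 'h) \<Rightarrow> (real \<Rightarrow> 'a \<Rightarrow> 'h) \<Rightarrow> bool" where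
  "wiener_process M F Q W \<longleftrightarrow>
     (\<forall>t\<ge>0. W t \<in> borel_measurable (F t)) \<and>
     (AE \<omega> in M. W 0 \<omega> = 0) \<and>
     (AE \<omega> in M. continuous_on {0..} (\<lambda>t. W t \<omega>)) \<and>
     (\<forall>s t. 0 \<le> s \<and> s \<le> t \<longrightarrow>
        centered_gaussian M (\<lambda>\<omega>. W t \<omega> - W s \<omega>) ((t - s) *\<^sub>R Q) \<and>
        prob_space.indep_set M (sets (F s))
          (sets (vimage_algebra (space M) (\<lambda>\<omega>. W t \<omega> - W s \<omega>) borel)))"


subsection \<open>Stochastic integral\<close>

text \<open>
  An elementary \<open>L(H)\<close>-valued process on \<open>[0, T]\<close>, constant in time on the intervals
  \<open>(\<tau> i, \<tau> (i + 1)]\<close> for \<open>i < n\<close>, with a finitely-valued coefficient \<open>\<xi> i\<close> known at time \<open>\<tau> i\<close>.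
\<close>

definition elementary_data ::
  "(real \<Rightarrow> 'a measure) \<Rightarrow> real \<Rightarrow> nat \<Rightarrow> (nat \<Rightarrow> real) \<Rightarrow>
   (nat \<Rightarrow> 'a \<Rightarrow> 'h::real_normed_vector \<Rightarrow>\<^sub>L 'h) \<Rightarrow> bool" where
  "elementary_data F T n \<tau> \<xi> \<longleftrightarrow>
     \<tau> 0 = 0 \<and> \<tau> n = T \<and>
     (\<forall>i<n. \<tau> i \<le> \<tau> (Suc i) \<and> simple_function (F (\<tau> i)) (\<xi> i))"

definition elementary_process ::
  "nat \<Rightarrow> (nat \<Rightarrow> real) \<Rightarrow> (nat \<Rightarrow> 'a \<Rightarrow> 'h::real_normed_vector \<Rightarrow>\<^sub>L 'h) \<Rightarrow>
   real \<Rightarrow> 'a \<Rightarrow> 'h \<Rightarrow>\<^sub>L 'h" where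
  "elementary_process n \<tau> \<xi> s \<omega> = (\<Sum>i<n. indicator {\<tau> i<..\<tau> (Suc i)} s *\<^sub>R \<xi> i \<omega>)"

definition elementary_integral ::
  "(real \<Rightarrow> 'a \<Rightarrow> 'h) \<Rightarrow> nat \<Rightarrow> (nat \<Rightarrow> real) \<Rightarrow>
   (nat \<Rightarrow> 'a \<Rightarrow> 'h::real_normed_vector \<Rightarrow>\<^sub>L 'h) \<Rightarrow> 'a \<Rightarrow> 'h" where
  "elementary_integral W n \<tau> \<xi> \<omega> =
     (\<Sum>i<n. blinfun_apply (\<xi> i \<omega>) (W (\<tau> (Suc i)) \<omega> - W (\<tau> i) \<omega>))"

text \<open>
  \<open>I\<close> is (a version of) the integral of \<open>\<Phi>\<close> against \<open>W\<close> over \<open>[0, T]\<close>: the \<open>L\<^sup>2(\<Omega>; H)\<close>-limit of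
  the integrals of elementary processes converging to \<open>\<Phi>\<close> in the norm of the Ito isometry,
  whose square is the expectation of the time integral of the squared Hilbert-Schmidt norm of
  \<open>\<Phi> Q\<^sup>1\<^sup>/\<^sup>2\<close>. The integrand is only required to be strongly measurable, since
  \<open>s \<mapsto> U (T - s)\<close> need not be measurable in operator norm.
\<close>

definition has_stochastic_integral ::
  "'a measure \<Rightarrow> (real \<Rightarrow> 'a measure) \<Rightarrow> ('h::real_inner \<Rightarrow>\<^sub>L 'h) \<Rightarrow> (real \<Rightarrow> 'a \<Rightarrow> 'h) \<Rightarrow>
   real \<Rightarrow> (real \<Rightarrow> 'a \<Rightarrow> 'h \<Rightarrow>\<^sub>L 'h) \<Rightarrow> ('a \<Rightarrow> 'h) \<Rightarrow> bool" where
  "has_stochastic_integral M F Q W T \<Phi> I \<longleftrightarrow>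
     I \<in> borel_measurable M \<and>
     (\<forall>x. (\<lambda>(s, \<omega>). blinfun_apply (\<Phi> s \<omega>) x)
          \<in> borel_measurable (restrict_space borel {0..T} \<Otimes>\<^sub>M M)) \<and>
     (\<exists>n \<tau> \<xi>.
        (\<forall>k. elementary_data F T (n k) (\<tau> k) (\<xi> k)) \<and>
        (\<lambda>k. \<integral>\<^sup>+\<omega>. (\<integral>\<^sup>+s\<in>{0..T}.
               hs_norm_sq (blinfun_apply
                 ((elementary_process (n k) (\<tau> k) (\<xi> k) s \<omega> - \<Phi> s \<omega>) o\<^sub>L op_sqrt Q))
             \<partial>lborel) \<partial>M) \<longlonglongrightarrow> 0 \<and>
        (\<lambda>k. \<integral>\<^sup>+\<omega>. ennreal ((norm (elementary_integral W (n k) (\<tau> k) (\<xi> k) \<omega> - I \<omega>))\<^sup>2) \<partial>M)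
           \<longlonglongrightarrow> 0)"

text \<open>
  The mild solution of \<open>dY(t) = A Y(t) dt + \<eta> dW(t)\<close>, \<open>Y(0) = Y\<^sub>0\<close>. Only the semigroup \<open>U\<close>
  generated by \<open>A\<close> enters. As the stochastic integral is a class of random variables modulo null
  sets, the identity defining the solution holds almost surely, for each \<open>t\<close>.
\<close>

definition mild_solution ::
  "'a measure \<Rightarrow> (real \<Rightarrow> 'a measure) \<Rightarrow> ('h::real_inner \<Rightarrow>\<^sub>L 'h) \<Rightarrow> (real \<Rightarrow> 'a \<Rightarrow> 'h) \<Rightarrow>
   (real \<Rightarrow> 'h \<Rightarrow>\<^sub>L 'h) \<Rightarrow> ('h \<Rightarrow>\<^sub>L 'h) \<Rightarrow> 'h \<Rightarrow> (real \<Rightarrow> 'a \<Rightarrow> 'h) \<Rightarrow> bool" where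
  "mild_solution M F Q W U \<eta> Y0 Y \<longleftrightarrow>
     (\<forall>t\<ge>0. Y t \<in> borel_measurable M \<and>
        (\<exists>I. has_stochastic_integral M F Q W t (\<lambda>s \<omega>. U (t - s) o\<^sub>L \<eta>) I \<and>
             (AE \<omega> in M. Y t \<omega> = blinfun_apply (U t) Y0 + I \<omega>)))"

definition heston_variance :: "(real \<Rightarrow> 'a \<Rightarrow> 'h::real_inner) \<Rightarrow> real \<Rightarrow> 'a \<Rightarrow> ('h \<Rightarrow> 'h)" where
  "heston_variance Y t \<omega> = tensor (Y t \<omega>) (Y t \<omega>)"

end

theory Submission
  imports Defs
begin

text \<open>The claim is pathwise: it holds for y \<otimes> y with any fixed vector y, here y =
  \<open>Y t \<omega>\<close>. Symmetry and positivity are read off from \<langle>(y \<otimes> y)f,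
  g\<rangle> = \<langle>y, f\<rangle>\<langle>y, g\<rangle>, which is symmetric in f and g and a
  square for f = g. For the Hilbert-Schmidt property, |(f \<otimes> g)e|^2 = \<langle>f,
  e\<rangle>^2 |g|^2, so by \<open>bessel_inequality\<close> the sum over an orthonormal basis is at
  most |f|^2 |g|^2.\<close>

lemma bessel_inequality:
  fixes y :: "'h::real_inner"
  assumes "finite E" and orth: "pairwise orthogonal E" and unit: "\<And>e. e \<in> E \<Longrightarrow> norm e = 1"
  shows "(\<Sum>e\<in>E. (y \<bullet> e)\<^sup>2) \<le> (norm y)\<^sup>2"
proof -
  \<comment> \<open>The orthogonal projection of y onto the span of E.\<close>
  define p where "p = (\<Sum>e\<in>E. (y \<bullet> e) *\<^sub>R e)"
  have pe: "p \<bullet> e = y \<bullet> e" if "e \<in> E" for e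
  proof -
    have "p \<bullet> e = (\<Sum>d\<in>E. if d = e then y \<bullet> e else 0)"
      unfolding p_def inner_sum_left
    proof (rule sum.cong)
      fix d assume "d \<in> E"
      then show "((y \<bullet> d) *\<^sub>R d) \<bullet> e = (if d = e then y \<bullet> e else 0)"
        using that orth unit[of e] by (auto simp: pairwise_def orthogonal_def dot_square_norm)
    qed simp
    then show ?thesis
      using that \<open>finite E\<close> by simp
  qed
  have yp: "y \<bullet> p = (\<Sum>e\<in>E. (y \<bullet> e)\<^sup>2)"
    by (simp add: p_def inner_sum_right power2_eq_square)
  have "p \<bullet> p = (\<Sum>e\<in>E. (y \<bullet> e) * (p \<bullet> e))"
    by (subst (2) p_def) (simp add: inner_sum_right)
  then have pp: "p \<bullet> p = (\<Sum>e\<in>E. (y \<bullet> e)\<^sup>2)"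
    using pe by (simp add: power2_eq_square)
  \<comment> \<open>With S the sum in question, \<langle>y, p\<rangle> = \<langle>p, p\<rangle> = S,
    so the right side expands to |y|^2 - 2S + S = |y|^2 - S.\<close>
  have "0 \<le> (y - p) \<bullet> (y - p)"
    by (rule inner_ge_zero)
  then show ?thesis
    using yp pp by (simp add: inner_diff inner_commute power2_norm_eq_inner)
qed

text \<open>The given \<open>B\<close> serves as the witness for the basis whose existence
  \<open>hilbert_schmidt\<close> demands.\<close>

lemma hilbert_schmidt_tensor:
  fixes f g :: "'h::real_inner" and B :: "'h set"
  assumes "orthonormal_basis B"
  shows "hilbert_schmidt (tensor f g)"
  unfolding hilbert_schmidt_def
proof (intro conjI exI)
  show "bounded_linear (tensor f g)"
    unfolding tensor_def
    by (rule bounded_linear_compose[OF bounded_linear_scaleR_left bounded_linear_inner_right])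
  show "orthonormal_basis B"
    by fact
  show "(\<lambda>e. (norm (tensor f g e))\<^sup>2) summable_on B"
  \<comment> \<open>The terms are nonnegative, so a uniform bound on finite partial sums suffices,
    and Bessel for finite sets is enough.\<close>
  proof (rule nonneg_bdd_above_summable_on)
    show "bdd_above (sum (\<lambda>e. (norm (tensor f g e))\<^sup>2) ` {E. E \<subseteq> B \<and> finite E})"
    proof (rule bdd_aboveI2)
      fix E assume "E \<in> {E. E \<subseteq> B \<and> finite E}"
      then have "(\<Sum>e\<in>E. (f \<bullet> e)\<^sup>2) \<le> (norm f)\<^sup>2"
        using assms by (intro bessel_inequality) (auto simp: orthonormal_basis_def intro: pairwise_subset)
      then show "(\<Sum>e\<in>E. (norm (tensor f g e))\<^sup>2) \<le> (norm f)\<^sup>2 * (norm g)\<^sup>2"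
        by (simp add: tensor_def power_mult_distrib mult_right_mono flip: sum_distrib_right)
    qed
  qed simp
qed

lemma symmetric_op_tensor_self: "symmetric_op (tensor y y)"
  by (simp add: symmetric_op_def tensor_def inner_commute)

lemma positive_definite_op_tensor_self: "positive_definite_op (tensor y y)"
  by (simp add: positive_definite_op_def tensor_def)

theorem proposition2:
  fixes M :: "'a measure"
    and F :: "real \<Rightarrow> 'a measure"
    and Q\<^sub>W \<eta> :: "'h::{real_inner, banach, second_countable_topology} \<Rightarrow>\<^sub>L 'h"
    and W Y :: "real \<Rightarrow> 'a \<Rightarrow> 'h"
    and D :: "'h set"
    and A :: "'h \<Rightarrow> 'h"
    and U :: "real \<Rightarrow> 'h \<Rightarrow>\<^sub>L 'h"
    and Y\<^sub>0 :: 'h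
  assumes "filtered_prob_space M F"
    and "symmetric_op (blinfun_apply Q\<^sub>W)"
    and "positive_definite_op (blinfun_apply Q\<^sub>W)"
    and "trace_class Q\<^sub>W"
    and "wiener_process M F Q\<^sub>W W"
    and "densely_defined_op D A"
    and "C0_semigroup U"
    and "generates_semigroup D A U"
    and "mild_solution M F Q\<^sub>W W U \<eta> Y\<^sub>0 Y"
  shows "\<forall>t\<ge>0. \<forall>\<omega>\<in>space M.
           hilbert_schmidt (heston_variance Y t \<omega>) \<and>
           symmetric_op (heston_variance Y t \<omega>) \<and>
           positive_definite_op (heston_variance Y t \<omega>)"
proof -
  \<comment> \<open>An orthonormal basis of H comes with the definition of a trace class
    operator.\<close>
  obtain B :: "'h set" where "orthonormal_basis B"
    using \<open>trace_class Q\<^sub>W\<close> by (auto simp: trace_class_def)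
  then show ?thesis
    by (simp add: heston_variance_def hilbert_schmidt_tensor
        symmetric_op_tensor_self positive_definite_op_tensor_self)
qed

end
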